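(* Let $k$ be any field and let $f\in k[t]$ with $\deg(f)\ge 2$. Suppose that $f(0)\neq 0$ and, further, that $f'(0)\neq 0$ when $\deg(f)=2$. Then there exists a normal non-congruence subgroup $N$ of $SL_2(k[t])$ of level $(f)$ with the following properties: (i) $N\cdot SL_2(k)=SL_2(k[t])$; (ii) $l(N)=(f)$; (iii) $ql(N)$ has $k$-codimension $1$ in $k[t]$.
   Context: Here $f'$ is the formal derivative of $f$. Put $D=k[t]$ and, for $r\in D$, $T(r)=\begin{pmatrix}1&r\\0&1\end{pmatrix}$. For a subgroup $H\le SL_2(D)$, the quasi-level $ql(H)$ is the set of $r\in D$ such that $T(r)$ lies in every conjugate of $H$ in $SL_2(D)$, and the level $l(H)$ is the largest ideal of $D$ contained in $ql(H)$. $H$ is a congruence subgroup if it contains $SL_2(D,\mathfrak{q})=\{X\in SL_2(D): X\equiv I_2\pmod{\mathfrak{q}}\}$ for some non-zero ideal $\mathfrak{q}$ of $D$, and a non-congruence subgroup otherwise. Property (iii) means that $ql(N)$ is a $k$-subspace of $k[t]$ and $\dim_k(k[t]/ql(N))=1$. *)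

theory Defs
  imports "HOL-Analysis.Determinants" "HOL-Algebra.QuotRing" "HOL-Computational_Algebra.Polynomial"
    "Jordan_Normal_Form.Missing_VectorSpace"
begin

definition type_ring :: "('a::comm_ring_1) ring" where
  "type_ring = \<lparr>carrier = UNIV, monoid.mult = (*), one = 1, zero = 0, add = (+)\<rparr>"

definition poly_space :: "('a::field, 'a poly) module" where
  "poly_space = \<lparr>carrier = UNIV, monoid.mult = (*), one = 1, zero = 0, add = (+),
     module.smult = Polynomial.smult\<rparr>"

text \<open>The quotient of a module \<open>V\<close> by a submodule \<open>W\<close>, with the cosets of \<open>W\<close> as elements. As in
  \<^const>\<open>rcoset_mult\<close>, scalar multiplication adds \<open>W\<close> back in: the elementwise multiple of a coset
  by \<open>0\<close> is just the singleton of zero. The fields \<open>mult\<close> and \<open>one\<close>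
  of the record play no role in modules.\<close>
definition quotient_space :: "('k, 'v) module \<Rightarrow> 'v set \<Rightarrow> ('k, 'v set) module" where
  "quotient_space V W = \<lparr>carrier = a_rcosets\<^bsub>V\<^esub> W, monoid.mult = undefined, one = undefined,
     zero = W, add = set_add V,
     module.smult = (\<lambda>c X. \<Union>x\<in>X. W +>\<^bsub>V\<^esub> (c \<odot>\<^bsub>V\<^esub> x))\<rparr>"

text \<open>\<open>vectorspace.dim\<close> is a natural number that is only meaningful
  for finite-dimensional spaces, hence the explicit \<open>fin_dim\<close>.\<close>
definition has_codim :: "'k ring \<Rightarrow> ('k, 'v) module \<Rightarrow> 'v set \<Rightarrow> nat \<Rightarrow> bool" where
  "has_codim K V W n \<longleftrightarrow> VectorSpace.subspace K W V \<and>
     vectorspace.fin_dim K (quotient_space V W) \<and> vectorspace.dim K (quotient_space V W) = n"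

definition SL2 :: "('a::comm_ring_1 ^ 2 ^ 2) monoid" where
  "SL2 = \<lparr>carrier = {A. det A = 1}, monoid.mult = (**), one = mat 1\<rparr>"

definition SL2_const :: "('a::field poly ^ 2 ^ 2) set" where
  "SL2_const = map_matrix (\<lambda>c. [:c:]) ` carrier SL2"

definition elem_T :: "'a::comm_ring_1 \<Rightarrow> 'a ^ 2 ^ 2" where
  "elem_T r = vector [vector [1, r], vector [0, 1]]"

definition quasi_level :: "('a::comm_ring_1 ^ 2 ^ 2) set \<Rightarrow> 'a set" where
  "quasi_level H =
     {r. \<forall>g\<in>carrier SL2. elem_T r \<in> (\<lambda>h. g \<otimes>\<^bsub>SL2\<^esub> h \<otimes>\<^bsub>SL2\<^esub> inv\<^bsub>SL2\<^esub> g) ` H}"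

text \<open>Largest with respect to inclusion. For a subgroup \<open>H\<close> it exists: \<open>quasi_level H\<close> is
  an additive subgroup and hence contains the sum of all ideals inside it.\<close>
definition level :: "('a::comm_ring_1 ^ 2 ^ 2) set \<Rightarrow> 'a set" where
  "level H = (GREATEST I. ideal I type_ring \<and> I \<subseteq> quasi_level H)"

definition SL2_cong :: "'a::comm_ring_1 set \<Rightarrow> ('a ^ 2 ^ 2) set" where
  "SL2_cong q = {X \<in> carrier SL2. \<forall>i j. X $ i $ j - mat 1 $ i $ j \<in> q}"

definition congruence_subgroup :: "('a::comm_ring_1 ^ 2 ^ 2) set \<Rightarrow> bool" where
  "congruence_subgroup H \<longleftrightarrow>
     subgroup H SL2 \<and> (\<exists>q. ideal q type_ring \<and> q \<noteq> {0} \<and> SL2_cong q \<subseteq> H)"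

definition noncongruence_subgroup :: "('a::comm_ring_1 ^ 2 ^ 2) set \<Rightarrow> bool" where
  "noncongruence_subgroup H \<longleftrightarrow> subgroup H SL2 \<and> \<not> congruence_subgroup H"


lemma cring_type_ring: "cring (type_ring :: 'a::comm_ring_1 ring)"
proof (intro cringI abelian_groupI comm_monoidI)
  fix x :: 'a
  show "\<exists>y\<in>carrier type_ring. y \<oplus>\<^bsub>type_ring\<^esub> x = \<zero>\<^bsub>type_ring\<^esub>"
    by (auto simp: type_ring_def intro: exI[of _ "- x"])
qed (auto simp: type_ring_def algebra_simps)

lemma field_type_ring: "Ring.field (type_ring :: 'a::field ring)"
proof (rule cring.cring_fieldI[OF cring_type_ring])
  have "x \<in> Units type_ring" if "x \<noteq> 0" for x :: 'a
    using that by (auto simp: Units_def type_ring_def intro!: exI[of _ "inverse x"])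
  then show "Units (type_ring :: 'a ring) = carrier type_ring - {\<zero>\<^bsub>type_ring\<^esub>}"
    by (auto simp: Units_def) (auto simp: type_ring_def)
qed

lemma vectorspace_poly_space: "vectorspace (type_ring :: 'a::field ring) poly_space"
proof (intro vectorspace.intro field_type_ring moduleI cring_type_ring abelian_groupI)
  fix x :: "'a poly"
  show "\<exists>y\<in>carrier poly_space. y \<oplus>\<^bsub>poly_space\<^esub> x = \<zero>\<^bsub>poly_space\<^esub>"
    by (auto simp: poly_space_def intro: exI[of _ "- x"])
qed (auto simp: type_ring_def poly_space_def smult_add_left smult_add_right)

lemma group_SL2: "group (SL2 :: ('a::comm_ring_1 ^ 2 ^ 2) monoid)"
proof (rule groupI)
  fix A :: "'a ^ 2 ^ 2" assume A: "A \<in> carrier SL2"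
  let ?B = "vector [vector [A$2$2, - A$1$2], vector [- A$2$1, A$1$1]] :: 'a ^ 2 ^ 2"
  have "det ?B = 1" "?B ** A = mat 1"
    using A by (auto simp: SL2_def det_2 matrix_matrix_mult_def mat_def vec_eq_iff sum_2 forall_2
        algebra_simps)
  then show "\<exists>y\<in>carrier SL2. y \<otimes>\<^bsub>SL2\<^esub> A = \<one>\<^bsub>SL2\<^esub>"
    by (auto simp: SL2_def)
qed (auto simp: SL2_def det_mul matrix_mul_assoc)

end

theory Submission
  imports Defs
begin

text \<open>Let \<open>\<pi>\<close> be a linear functional on \<open>k[t]\<close> with \<open>\<pi> 1 = 1\<close>. By Nagao's theorem
  \<open>SL\<^sub>2(k[t])\<close> is the amalgam of \<open>SL\<^sub>2(k)\<close> and the upper triangular matrices, so applying \<open>\<pi>\<close> to the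
  latter defines a retraction onto \<open>SL\<^sub>2(k)\<close>; it is constructed here directly from the Euclidean
  algorithm. Its kernel \<open>N\<close> is a normal complement of \<open>SL\<^sub>2(k)\<close> whose quasi-level is the kernel of
  \<open>\<pi>\<close>. With \<open>d = deg f\<close> and \<open>\<pi> p\<close> the coefficient of \<open>t\<^bsup>d-1\<^esup>\<close> in \<open>p t\<^bsup>d-1\<^esup> mod f\<close>, the largest ideal in
  the kernel of \<open>\<pi>\<close> is \<open>(f)\<close>, because \<open>t\<close> is a unit modulo \<open>f\<close>.

  If \<open>N\<close> contained a principal congruence subgroup modulo \<open>g\<close>, then for \<open>u \<equiv> t\<close> modulo \<open>f\<close> that is a
  unit modulo \<open>g\<close>, conjugation by a lift of \<open>diag(u, 1/u)\<close> would give \<open>\<pi>(u\<^sup>2 r) = a\<^sup>2 \<pi>(r)\<close> for a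
  constant \<open>a\<close> and all \<open>r\<close>. Hence \<open>f\<close> would divide \<open>t\<^sup>2 - a\<^sup>2\<close>, which the hypotheses exclude.\<close>

section \<open>Two-by-two matrices\<close>

definition mat2 :: "'a::zero \<Rightarrow> 'a \<Rightarrow> 'a \<Rightarrow> 'a \<Rightarrow> 'a ^ 2 ^ 2" where
  "mat2 a b c d = vector [vector [a, b], vector [c, d]]"

lemma mat2_nth [simp]:
  "mat2 a b c d $ 1 $ 1 = a" "mat2 a b c d $ 1 $ 2 = b"
  "mat2 a b c d $ 2 $ 1 = c" "mat2 a b c d $ 2 $ 2 = d"
  by (simp_all add: mat2_def)

lemma mat2_eta: "mat2 (A $ 1 $ 1) (A $ 1 $ 2) (A $ 2 $ 1) (A $ 2 $ 2) = A"
  by (simp add: vec_eq_iff forall_2)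

lemma mat2_eq_iff [simp]: "mat2 a b c d = mat2 a' b' c' d' \<longleftrightarrow> a = a' \<and> b = b' \<and> c = c' \<and> d = d'"
  by (auto simp: vec_eq_iff forall_2)

lemma mat2_mult [simp]:
  "mat2 a b c d ** mat2 a' b' c' d' =
     mat2 (a * a' + b * c') (a * b' + b * d') (c * a' + d * c') (c * b' + d * d')"
  by (simp add: vec_eq_iff forall_2 matrix_matrix_mult_def sum_2)

lemma det_mat2 [simp]: "det (mat2 a b c d) = a * d - b * c"
  by (simp add: det_2)

lemma mat_1_eq_mat2: "mat 1 = mat2 1 0 0 1"
  by (simp add: vec_eq_iff forall_2 mat_def)

lemma elem_T_eq_mat2: "elem_T r = mat2 1 r 0 1"
  by (simp add: elem_T_def mat2_def)

lemma in_carrier_SL2_iff: "A \<in> carrier SL2 \<longleftrightarrow> det A = 1"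
  by (simp add: SL2_def)

lemma one_SL2: "\<one>\<^bsub>SL2\<^esub> = mat 1"
  by (simp add: SL2_def)

section \<open>The retraction onto the constant matrices\<close>

text \<open>Triangular matrices of determinant 1 have constant diagonal entries, so linearity of
  \<open>\<pi>\<close> is enough to handle products with them.\<close>

lemma poly_unit_pair:
  fixes a d :: "'a::field poly"
  assumes "a * d = 1"
  obtains u where "u \<noteq> 0" "a = [:u:]" "d = [:inverse u:]"
proof -
  have "is_unit a" "is_unit d"
    using assms by (metis dvdI dvd_triv_right)+
  then obtain u v where "a = [:u:]" "u dvd 1" "d = [:v:]"
    unfolding is_unit_poly_iff by blast
  moreover from this have "u \<noteq> 0"
    by auto
  moreover have "u * v = 1"
    using assms \<open>a = [:u:]\<close> \<open>d = [:v:]\<close> by (simp add: one_pCons mult.commute)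
  then have "v = inverse u"
    by (metis inverse_unique)
  ultimately show thesis
    using that by blast
qed

abbreviation weyl :: "'a::comm_ring_1 ^ 2 ^ 2" where
  "weyl \<equiv> mat2 0 (- 1) 1 0"

text \<open>The normalization makes \<open>\<pi>\<close> fix constants, so the map built from it
  restricts to the identity on SL2(k).\<close>

locale normalized_functional =
  fixes \<pi> :: "'a::field poly \<Rightarrow> 'a"
  assumes add: "\<pi> (p + q) = \<pi> p + \<pi> q"
    and smult: "\<pi> (Polynomial.smult c p) = c * \<pi> p"
    and one: "\<pi> 1 = 1"
begin

lemma zero [simp]: "\<pi> 0 = 0"
  using smult[of 0 0] by simp

lemma const [simp]: "\<pi> [:c:] = c"
  using smult[of c 1] one by simp

lemma minus: "\<pi> (- p) = - \<pi> p"
  using smult[of "- 1" p] by simp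

lemma diff: "\<pi> (p - q) = \<pi> p - \<pi> q"
  using add[of p "- q"] minus[of q] by simp

text \<open>Row reduction by the Euclidean algorithm on the first column writes a matrix as a product of
  factors \<open>elem_T q ** weyl\<close> and an upper triangular matrix; \<open>\<pi>\<close> is applied to each factor.\<close>

function retract :: "'a poly \<Rightarrow> 'a poly \<Rightarrow> 'a poly \<Rightarrow> 'a poly \<Rightarrow> 'a ^ 2 ^ 2" where
  "retract a b c d =
     (if c = 0 then mat2 (\<pi> a) (\<pi> b) 0 (\<pi> d)
      else elem_T (\<pi> (a div c)) ** weyl ** retract c d (- (a mod c)) ((a div c) * d - b))"
  by pat_completeness auto
termination
  \<comment> \<open>The shift by \<open>Suc\<close> ranks a zero remainder strictly below a nonzero
    constant.\<close>
  by (relation "measure (\<lambda>(a, b, c, d). if c = 0 then 0 else Suc (degree c))")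
    (auto dest: degree_mod_less')

declare retract.simps [simp del]

lemma retract_triangular: "retract a b 0 d = mat2 (\<pi> a) (\<pi> b) 0 (\<pi> d)"
  by (simp add: retract.simps)

lemma retract_step:
  "c \<noteq> 0 \<Longrightarrow> retract a b c d =
     elem_T (\<pi> (a div c)) ** weyl ** retract c d (- (a mod c)) ((a div c) * d - b)"
  by (simp add: retract.simps[of a b c d])

text \<open>Adding \<open>r\<close> times the bottom row to the top row raises the first quotient by
  \<open>r\<close> and leaves the next matrix unchanged. If \<open>c = 0\<close>, then
  \<open>d\<close> is constant and linearity of \<open>\<pi>\<close> suffices.\<close>

lemma retract_elem:
  assumes "a * d - b * c = 1"
  shows "retract (a + r * c) (b + r * d) c d = elem_T (\<pi> r) ** retract a b c d"
proof (cases "c = 0")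
  case True
  with assms obtain u where "u \<noteq> 0" "a = [:u:]" "d = [:inverse u:]"
    by (auto elim: poly_unit_pair)
  with True show ?thesis
    by (simp add: retract_triangular elem_T_eq_mat2 add smult mult.commute)
next
  case False
  then have "(a + r * c) div c = a div c + r" "(a + r * c) mod c = a mod c"
    by simp_all
  moreover have "(a div c + r) * d - (b + r * d) = (a div c) * d - b"
    by (simp add: algebra_simps)
  moreover have "elem_T (\<pi> (a div c + r)) = elem_T (\<pi> r) ** elem_T (\<pi> (a div c))"
    by (simp add: elem_T_eq_mat2 add)
  ultimately show ?thesis
    by (simp only: retract_step[OF False] matrix_mul_assoc)
qed

text \<open>Scaling the rows by \<open>u\<close> and \<open>v = 1/u\<close> multiplies the quotient
  by \<open>u * u\<close> and scales the rows of the next matrix by \<open>v\<close> and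
  \<open>u\<close>, so the induction swaps the two scalars.\<close>

lemma retract_diag:
  assumes "u * v = 1"
  shows "retract (Polynomial.smult u a) (Polynomial.smult u b) (Polynomial.smult v c) (Polynomial.smult v d) =
     mat2 u 0 0 v ** retract a b c d"
  using assms
proof (induction a b c d arbitrary: u v rule: retract.induct)
  case (1 a b c d)
  have uv: "u \<noteq> 0" "v = inverse u"
    using 1(2) by (auto simp: inverse_unique)
  show ?case
  proof (cases "c = 0")
    case True
    then show ?thesis
      by (simp add: retract_triangular smult)
  next
    case False
    have IH: "retract (Polynomial.smult v c) (Polynomial.smult v d)
        (Polynomial.smult u (- (a mod c))) (Polynomial.smult u ((a div c) * d - b)) =
        mat2 v 0 0 u ** retract c d (- (a mod c)) ((a div c) * d - b)"
      using 1(1)[OF False, of v u] 1(2) by (simp add: mult.commute)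
    have "Polynomial.smult u a div Polynomial.smult v c = Polynomial.smult (u * u) (a div c)"
      "Polynomial.smult u a mod Polynomial.smult v c = Polynomial.smult u (a mod c)"
      using uv by (simp_all add: div_smult_left div_smult_right mod_smult_left mod_smult_right)
    moreover have "Polynomial.smult (u * u) (a div c) * Polynomial.smult v d - Polynomial.smult u b =
        Polynomial.smult u ((a div c) * d - b)"
    proof -
      have "v * (u * u) = u"
        using uv by simp
      then have "Polynomial.smult v (Polynomial.smult (u * u) p) = Polynomial.smult u p" for p
        by (simp only: smult_smult)
      then show ?thesis
        by (simp only: mult_smult_left mult_smult_right smult_diff_right)
    qed
    moreover have "elem_T (u * u * x) ** weyl ** mat2 v 0 0 u = mat2 u 0 0 v ** elem_T x ** weyl" for x
      using uv by (simp add: elem_T_eq_mat2)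
    ultimately show ?thesis
      using False uv IH
      by (simp add: retract_step smult matrix_mul_assoc)
  qed
qed

text \<open>Multiplication by \<open>weyl\<close> undoes a step of the Euclidean algorithm here; in general it is
  reduced to this case by the relations of \<open>SL\<^sub>2(k)\<close>.\<close>

lemma retract_weyl_aux:
  assumes "a \<noteq> 0" "c = 0 \<or> degree c < degree a"
  shows "retract (- c) (- d) a b = weyl ** retract a b c d"
proof -
  have "- c div a = 0" "- c mod a = - c"
    using assms by (auto simp: div_poly_less mod_poly_less)
  then show ?thesis
    using assms(1) by (simp add: retract_step elem_T_eq_mat2)
qed

lemma retract_weyl:
  assumes det: "a * d - b * c = 1"
  shows "retract (- c) (- d) a b = weyl ** retract a b c d"
proof -
  consider "a \<noteq> 0" "c = 0 \<or> degree c < degree a" | "c \<noteq> 0" "a = 0 \<or> degree a < degree c"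
    | "a \<noteq> 0" "c \<noteq> 0" "degree a = degree c"
    using det by fastforce
  then show ?thesis
  proof cases
    case 1
    then show ?thesis
      by (rule retract_weyl_aux)
  next
    case 2
    then have *: "a div c = 0" "a mod c = a"
      by (auto simp: div_poly_less mod_poly_less)
    \<comment> \<open>The first quotient is 0, so \<open>retract a b c d\<close> starts with
      \<open>elem_T 0 ** weyl\<close>, and \<open>weyl\<close> squares to -1.\<close>
    have "retract (- c) (- d) a b = mat2 (- 1) 0 0 (- 1) ** retract c d (- a) (- b)"
      using retract_diag[of "- 1" "- 1" c d "- a" "- b"] by simp
    also have "mat2 (- 1) 0 0 (- 1) = weyl ** elem_T 0 ** (weyl :: 'a ^ 2 ^ 2)"
      by (simp add: elem_T_eq_mat2)
    finally show ?thesis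
      using 2 * by (simp add: retract_step matrix_mul_assoc)
  next
    case 3
    \<comment> \<open>The primed matrix is the result of one Euclidean step. Equal degrees force
      \<open>q\<close> to be a nonzero constant \<open>y\<close>.\<close>
    define q where "q = a div c"
    define a' b' c' d' where "a' = c" "b' = d" "c' = - (a mod c)" "d' = q * d - b"
    note defs = a'_b'_c'_d'_def
    have a: "a = q * c + a mod c"
      by (simp add: q_def)
    have small: "c' = 0 \<or> degree c' < degree c"
      using degree_mod_less[OF \<open>c \<noteq> 0\<close>, of a] by (auto simp: defs)
    have "q \<noteq> 0"
      using a small 3 by (auto simp: defs)
    then have "degree (q * c) = degree q + degree c"
      using 3 by (simp add: degree_mult_eq)
    moreover have "degree (a + c') \<le> degree c"
      using degree_add_le[of a "degree c" c'] small 3 by auto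
    moreover have "a + c' = q * c"
      using a by (simp add: defs algebra_simps)
    ultimately have "degree q = 0"
      by simp
    then obtain y where q: "q = [:y:]"
      by (elim degree_eq_zeroE)
    with \<open>q \<noteq> 0\<close> have y: "y \<noteq> 0"
      by auto
    \<comment> \<open>With this value, \<open>weyl ** elem_T y ** weyl\<close> has the Bruhat form
      \<open>elem_T z ** weyl ** mat2 y 0 0 (inverse y) ** elem_T z\<close>.\<close>
    define z where "z = - inverse y"
    have det': "a' * d' - b' * c' = 1"
    proof -
      have "a' * d' - b' * c' = (q * c + a mod c) * d - b * c"
        by (simp add: defs algebra_simps)
      with a det show ?thesis
        by simp
    qed
    \<comment> \<open>These identities, and \<open>top\<close> below, track the rows as the factors
      of the Bruhat form act in turn on the primed matrix.\<close>
    have bot: "Polynomial.smult y (a' + [:z:] * c') = a" "Polynomial.smult y (b' + [:z:] * d') = b"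
      using y a by (simp_all add: defs z_def q smult_add_right smult_diff_right)
    have "a = Polynomial.smult y c - c'" "b = Polynomial.smult y d - d'"
      using a by (simp_all add: defs q)
    then have top: "- Polynomial.smult (inverse y) c' + [:z:] * a = - c"
        "- Polynomial.smult (inverse y) d' + [:z:] * b = - d"
      using y by (simp_all add: z_def smult_diff_right)
    have "retract (- c) (- d) a b =
        elem_T z ** retract (- Polynomial.smult (inverse y) c') (- Polynomial.smult (inverse y) d') a b"
    proof -
      have "(- Polynomial.smult (inverse y) c') * b - (- Polynomial.smult (inverse y) d') * a = 1"
      proof -
        have "(- Polynomial.smult (inverse y) c') * b - (- Polynomial.smult (inverse y) d') * a
            = (- c - [:z:] * a) * b - (- d - [:z:] * b) * a"
          using top by (metis add_diff_cancel_right')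
        also have "\<dots> = a * d - b * c"
          by (simp add: algebra_simps)
        finally show ?thesis
          using det by simp
      qed
      from retract_elem[OF this, of "[:z:]"] top show ?thesis
        by simp
    qed
    \<comment> \<open>The reduced case applies: \<open>c'\<close> is 0 or of smaller degree than
      \<open>c\<close>, whose degree is that of \<open>a\<close>.\<close>
    also have "retract (- Polynomial.smult (inverse y) c') (- Polynomial.smult (inverse y) d') a b =
        weyl ** retract a b (Polynomial.smult (inverse y) c') (Polynomial.smult (inverse y) d')"
      using 3 small y by (intro retract_weyl_aux) auto
    also have "retract a b (Polynomial.smult (inverse y) c') (Polynomial.smult (inverse y) d') =
        mat2 y 0 0 (inverse y) ** retract (a' + [:z:] * c') (b' + [:z:] * d') c' d'"
      using retract_diag[of y "inverse y" "a' + [:z:] * c'" "b' + [:z:] * d'" c' d'] y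
      unfolding bot by simp
    also have "retract (a' + [:z:] * c') (b' + [:z:] * d') c' d' = elem_T z ** retract a' b' c' d'"
      using retract_elem[OF det', of "[:z:]"] by simp
    also have "elem_T z ** (weyl ** (mat2 y 0 0 (inverse y) ** (elem_T z ** retract a' b' c' d'))) =
        weyl ** (elem_T y ** weyl ** retract a' b' c' d')"
      using y by (simp add: matrix_mul_assoc elem_T_eq_mat2 z_def)
    also have "elem_T y ** weyl ** retract a' b' c' d' = retract a b c d"
      using \<open>c \<noteq> 0\<close> q by (simp add: retract_step[of c] defs flip: q_def)
    finally show ?thesis .
  qed
qed

section \<open>The retraction is a group homomorphism\<close>

definition retraction :: "'a poly ^ 2 ^ 2 \<Rightarrow> 'a ^ 2 ^ 2" where
  "retraction A = retract (A $ 1 $ 1) (A $ 1 $ 2) (A $ 2 $ 1) (A $ 2 $ 2)"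

lemma retraction_mat2 [simp]: "retraction (mat2 a b c d) = retract a b c d"
  by (simp add: retraction_def)

lemma retraction_elem_T: "retraction (elem_T r) = elem_T (\<pi> r)"
  by (simp add: elem_T_eq_mat2 retract_triangular one)

text \<open>Division of constants is exact, so the algorithm stops after at most one step, and the
  factors multiply back to \<open>A\<close>.\<close>

lemma retraction_const: "retraction (map_matrix (\<lambda>c. [:c:]) A) = A"
proof -
  obtain a b c d where A: "A = mat2 a b c d"
    using mat2_eta[of A] by metis
  have "map_matrix (\<lambda>c. [:c:]) A = mat2 [:a:] [:b:] [:c:] [:d:]"
    by (simp add: A vec_eq_iff forall_2)
  moreover have "[:a:] div [:c:] = [:a / c:]" "[:a:] mod [:c:] = 0" if "c \<noteq> 0"
  proof -
    have "[:a:] = [:a / c:] * [:c:]"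
      using that by simp
    then show "[:a:] div [:c:] = [:a / c:]" "[:a:] mod [:c:] = 0"
      using that by (metis nonzero_mult_div_cancel_right pCons_eq_0_iff, metis mod_mult_self2_is_0)
  qed
  ultimately show ?thesis
    by (cases "c = 0") (simp_all add: A retract_triangular retract_step elem_T_eq_mat2)
qed

text \<open>This property passes to products, so multiplicativity has to be checked only for
  generators as left factors.\<close>

definition multiplier :: "'a poly ^ 2 ^ 2 \<Rightarrow> bool" where
  "multiplier A \<longleftrightarrow> det A = 1 \<and> det (retraction A) = 1 \<and>
     (\<forall>B. det B = 1 \<longrightarrow> retraction (A ** B) = retraction A ** retraction B)"

lemma multiplier_mult: "multiplier A \<Longrightarrow> multiplier B \<Longrightarrow> multiplier (A ** B)"
  by (auto simp: multiplier_def det_mul simp flip: matrix_mul_assoc)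

lemma multiplier_elem_T: "multiplier (elem_T r)"
proof -
  have "retraction (elem_T r ** B) = retraction (elem_T r) ** retraction B" if "det B = 1" for B
    using that retract_elem[of "B $ 1 $ 1" "B $ 2 $ 2" "B $ 1 $ 2" "B $ 2 $ 1" r]
      mat2_mult[of 1 r 0 1 "B $ 1 $ 1" "B $ 1 $ 2" "B $ 2 $ 1" "B $ 2 $ 2"]
    by (simp add: mat2_eta det_2 elem_T_eq_mat2 retract_triangular one retraction_def)
  then show ?thesis
    by (simp add: multiplier_def retraction_elem_T) (simp add: elem_T_eq_mat2)
qed

lemma multiplier_diag:
  assumes "u \<noteq> 0"
  shows "multiplier (mat2 [:u:] 0 0 [:inverse u:])"
proof -
  have "retraction (mat2 [:u:] 0 0 [:inverse u:] ** B) = retraction (mat2 [:u:] 0 0 [:inverse u:]) ** retraction B" for B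
    using retract_diag[of u "inverse u" "B $ 1 $ 1" "B $ 1 $ 2" "B $ 2 $ 1" "B $ 2 $ 2"] assms
      mat2_mult[of "[:u:]" 0 0 "[:inverse u:]" "B $ 1 $ 1" "B $ 1 $ 2" "B $ 2 $ 1" "B $ 2 $ 2"]
    by (simp add: mat2_eta retract_triangular retraction_def)
  with assms show ?thesis
    by (simp add: multiplier_def retract_triangular one_pCons)
qed

lemma multiplier_weyl: "multiplier weyl"
proof -
  have W: "retraction weyl = weyl"
    by (simp add: retract_step retract_triangular elem_T_eq_mat2 one minus)
  have "retraction (weyl ** B) = retraction weyl ** retraction B" if "det B = 1" for B
    unfolding W
    using that retract_weyl[of "B $ 1 $ 1" "B $ 2 $ 2" "B $ 1 $ 2" "B $ 2 $ 1"]
      mat2_mult[of 0 "- 1" 1 0 "B $ 1 $ 1" "B $ 1 $ 2" "B $ 2 $ 1" "B $ 2 $ 2"]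
    by (simp add: mat2_eta det_2 retraction_def)
  with W show ?thesis
    by (simp add: multiplier_def del: retraction_mat2)
qed

text \<open>The Euclidean algorithm factors the matrix into elementary, diagonal and Weyl matrices,
  all of which are multipliers.\<close>

lemma multiplier_mat2: "a * d - b * c = 1 \<Longrightarrow> multiplier (mat2 a b c d)"
proof (induction a b c d rule: retract.induct)
  case (1 a b c d)
  show ?case
  proof (cases "c = 0")
    case True
    with 1(2) obtain u where u: "u \<noteq> 0" "a = [:u:]" "d = [:inverse u:]"
      by (auto elim: poly_unit_pair)
    then have "mat2 a b c d = elem_T ([:u:] * b) ** mat2 [:u:] 0 0 [:inverse u:]"
      using True by (simp add: elem_T_eq_mat2 mult.commute)
    then show ?thesis
      using multiplier_mult multiplier_elem_T multiplier_diag u(1) by simp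
  next
    case False
    have "c * (a div c * d - b) - d * - (a mod c) = (a div c * c + a mod c) * d - b * c"
      unfolding left_diff_distrib right_diff_distrib distrib_right by simp
    then have "multiplier (mat2 c d (- (a mod c)) (a div c * d - b))"
      using 1 False by simp
    moreover have "mat2 a b c d =
        elem_T (a div c) ** weyl ** mat2 c d (- (a mod c)) (a div c * d - b)"
      by (simp add: elem_T_eq_mat2)
    ultimately show ?thesis
      using multiplier_mult multiplier_elem_T multiplier_weyl by simp
  qed
qed

lemma multiplier_SL2: "det A = 1 \<Longrightarrow> multiplier A"
  using multiplier_mat2[of "A $ 1 $ 1" "A $ 2 $ 2" "A $ 1 $ 2" "A $ 2 $ 1"]
  by (simp add: mat2_eta det_2)

lemma group_hom_retraction: "group_hom SL2 SL2 retraction"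
  using multiplier_SL2
  by (intro group_hom.intro group_SL2 group_hom_axioms.intro)
    (auto simp: hom_def SL2_def multiplier_def)

end

section \<open>Invertible elements modulo a polynomial\<close>

lemma invertible_mod_mult:
  fixes u :: "'a::comm_ring_1"
  assumes "\<exists>v. g dvd 1 - u * v" "\<exists>v. h dvd 1 - u * v"
  shows "\<exists>v. g * h dvd 1 - u * v"
proof -
  from assms obtain v w where "g dvd 1 - u * v" "h dvd 1 - u * w"
    by blast
  then have "g * h dvd (1 - u * v) * (1 - u * w)"
    by (rule mult_dvd_mono)
  also have "(1 - u * v) * (1 - u * w) = 1 - u * (v + w - u * v * w)"
    by (simp add: algebra_simps)
  finally show ?thesis
    by blast
qed

text \<open>Writing \<open>f\<close> as \<open>c + t h\<close> with \<open>c = f(0)\<close> nonzero,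
  \<open>- h / c\<close> inverts \<open>t\<close> modulo \<open>f\<close>.\<close>

lemma X_invertible_mod:
  fixes f :: "'a::field poly"
  assumes "poly f 0 \<noteq> 0"
  shows "\<exists>v. f dvd 1 - [:0, 1:] * v"
proof -
  obtain c h where f: "f = pCons c h"
    by (cases f)
  with assms have "c \<noteq> 0"
    by simp
  then have "1 - [:0, 1:] * Polynomial.smult (- inverse c) h = Polynomial.smult (inverse c) f"
    by (simp add: f one_pCons)
  then show ?thesis
    by (metis dvd_refl dvd_smult)
qed

lemma invertible_mod_mult_left:
  fixes a b :: "'a::comm_ring_1"
  assumes "\<exists>v. g dvd 1 - a * v" "\<exists>v. g dvd 1 - b * v"
  shows "\<exists>v. g dvd 1 - a * b * v"
proof -
  from assms obtain v w where "g dvd 1 - a * v" "g dvd 1 - b * w"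
    by blast
  then have "g dvd (1 - a * v) + a * v * (1 - b * w)"
    by simp
  also have "(1 - a * v) + a * v * (1 - b * w) = 1 - a * b * (v * w)"
    by (simp add: algebra_simps)
  finally show ?thesis
    by blast
qed

lemma invertible_mod_cong:
  fixes u :: "'a::comm_ring_1"
  assumes "\<exists>v. g dvd 1 - u * v" "g dvd u - u'"
  shows "\<exists>v. g dvd 1 - u' * v"
proof -
  from assms(1) obtain v where "g dvd 1 - u * v"
    by blast
  then have "g dvd (1 - u * v) + (u - u') * v"
    using assms(2) by simp
  then have "g dvd 1 - u' * v"
    by (simp add: algebra_simps)
  then show ?thesis ..
qed

lemma obtain_invertible_mod_cong_X:
  fixes f g :: "'a::field poly"
  assumes f: "poly f 0 \<noteq> 0" and g: "g \<noteq> 0"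
  obtains u v where "f dvd u - [:0, 1:]" "g dvd 1 - u * v"
proof -
  obtain h where h: "g = [:- 0, 1:] ^ order 0 g * h" "\<not> [:- 0, 1:] dvd h"
    using order_decomp[OF g] by blast
  then have h0: "poly h 0 \<noteq> 0"
    by (simp add: poly_eq_0_iff_dvd)
  \<comment> \<open>Modulo \<open>h\<close> this is \<open>t\<close>, a unit since
    \<open>h(0)\<close> is nonzero. Modulo \<open>t\<close> it is the nonzero constant
    \<open>f(0) h(0)\<close>, so it is a unit modulo every power of \<open>t\<close>.\<close>
  define u where "u = [:0, 1:] + f * h"
  define v where "v = [:inverse (poly f 0 * poly h 0):]"
  have "poly (1 - u * v) 0 = 0"
    using f h0 by (simp add: u_def v_def field_simps)
  then have "[:0, 1:] dvd 1 - u * v"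
    by (metis poly_eq_0_iff_dvd minus_zero)
  then have "\<exists>v. [:0, 1:] dvd 1 - u * v"
    by blast
  then have "\<exists>v. [:0, 1:] ^ n dvd 1 - u * v" for n
  proof (induction n)
    case (Suc n)
    with \<open>\<exists>v. [:0, 1:] dvd 1 - u * v\<close> show ?case
      by (simp only: power_Suc invertible_mod_mult)
  qed simp
  moreover have "\<exists>v. h dvd 1 - u * v"
    using X_invertible_mod[OF h0] by (rule invertible_mod_cong) (simp add: u_def)
  ultimately have "\<exists>v. g dvd 1 - u * v"
    by (subst h(1)) (simp add: invertible_mod_mult)
  then show thesis
    using that[of u] by (auto simp: u_def)
qed

lemma ideal_multiples: "ideal {p. f dvd p} (type_ring :: 'a::comm_ring_1 ring)"
proof (intro idealI subgroup.intro)
  show "ring (type_ring :: 'a ring)"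
    using cring_type_ring cring.axioms(1) by blast
  fix x :: 'a
  assume "x \<in> {p. f dvd p}"
  have "inv\<^bsub>add_monoid type_ring\<^esub> x = - x"
    using cring_type_ring
    by (intro group.inv_equality abelian_group.a_group ring.is_abelian_group cring.axioms(1))
      (auto simp: type_ring_def)
  then show "inv\<^bsub>add_monoid type_ring\<^esub> x \<in> {p. f dvd p}"
    using \<open>x \<in> _\<close> by simp
qed (auto simp: type_ring_def)

lemma genideal_type_ring: "Idl\<^bsub>type_ring\<^esub> {f} = {p :: 'a::comm_ring_1. f dvd p}"
proof
  have R: "ring (type_ring :: 'a ring)"
    using cring_type_ring cring.axioms(1) by blast
  show "Idl\<^bsub>type_ring\<^esub> {f} \<subseteq> {p. f dvd p}"
    using ring.genideal_minimal[OF R ideal_multiples] by simp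
  have I: "ideal (Idl\<^bsub>type_ring\<^esub> {f}) type_ring" "f \<in> Idl\<^bsub>type_ring\<^esub> {f}"
    using ring.genideal_ideal[OF R] ring.genideal_self'[OF R] by (auto simp: type_ring_def)
  show "{p. f dvd p} \<subseteq> Idl\<^bsub>type_ring\<^esub> {f}"
    using ideal.I_r_closed[OF I] by (auto simp: type_ring_def elim!: dvdE)
qed

section \<open>The codimension of the kernel of a functional\<close>

context normalized_functional
begin

text \<open>The cosets of the kernel are the fibres \<open>F y\<close> of \<open>\<pi>\<close>, with
  the operations of k on the index \<open>y\<close>; hence \<open>F 1\<close> spans the
  quotient.\<close>

lemma has_codim_kernel: "has_codim type_ring poly_space {p. \<pi> p = 0} 1"
proof -
  define F where "F y = {p. \<pi> p = y}" for y
  define Q where "Q = quotient_space poly_space (F 0)"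
  have F_ne: "[:y:] \<in> F y" for y
    by (simp add: F_def)
  have F_inj [simp]: "F x = F y \<longleftrightarrow> x = y" for x y
    using F_ne[of x] by (metis F_def const mem_Collect_eq)
  have coset: "F 0 +>\<^bsub>poly_space\<^esub> p = F (\<pi> p)" for p
  proof -
    have "\<exists>h. \<pi> h = 0 \<and> q = h + p" if "\<pi> q = \<pi> p" for q
      by (rule exI[of _ "q - p"]) (simp add: that diff)
    then show ?thesis
      by (auto simp: F_def a_r_coset_def r_coset_def poly_space_def add)
  qed
  have carrier: "carrier Q = range F"
  proof -
    have "carrier Q = range (\<lambda>p. F 0 +>\<^bsub>poly_space\<^esub> p)"
      by (auto simp: Q_def quotient_space_def A_RCOSETS_def RCOSETS_def a_r_coset_def)
        (auto simp: poly_space_def)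
    also have "\<dots> = F ` range \<pi>"
      by (simp add: coset image_image)
    also have "range \<pi> = UNIV"
      using surjI[of \<pi> "\<lambda>c. [:c:]"] by simp
    finally show ?thesis .
  qed
  have zero: "\<zero>\<^bsub>Q\<^esub> = F 0"
    by (simp add: Q_def quotient_space_def)
  have add_F: "F x \<oplus>\<^bsub>Q\<^esub> F y = F (x + y)" for x y
  proof -
    have "\<exists>h k. \<pi> h = x \<and> \<pi> k = y \<and> q = h + k" if "\<pi> q = x + y" for q
      by (rule exI[of _ "q - [:y:]"], rule exI[of _ "[:y:]"]) (simp add: that diff)
    then show ?thesis
      by (fastforce simp: Q_def quotient_space_def F_def set_add_def set_mult_def poly_space_def add)
  qed
  have smult_F: "c \<odot>\<^bsub>Q\<^esub> F y = F (c * y)" for c y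
  proof -
    have "c \<odot>\<^bsub>Q\<^esub> F y = (\<Union>p\<in>F y. F (\<pi> (Polynomial.smult c p)))"
      by (simp add: Q_def quotient_space_def coset) (simp add: poly_space_def)
    also have "\<dots> = (\<Union>p\<in>F y. F (c * y))"
      by (simp add: F_def smult)
    finally show ?thesis
      using F_ne[of y] by auto
  qed
  have "\<exists>z. F z \<oplus>\<^bsub>Q\<^esub> F y = F 0" for y
    by (rule exI[of _ "- y"]) (simp add: add_F)
  then interpret Q: vectorspace type_ring Q
    by (intro vectorspace.intro field_type_ring moduleI cring_type_ring abelian_groupI)
      (auto simp: carrier zero add_F smult_F type_ring_def algebra_simps)
  have lincomb: "Q.lincomb a {F 1} = F (a (F 1))" for a
    unfolding Q.lincomb_def
    using Q.finsum_insert[of "{}" "F 1" "\<lambda>v. a v \<odot>\<^bsub>Q\<^esub> v"]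
    by (auto simp: carrier smult_F zero add_F)
  have span: "Q.span {F 1} = carrier Q"
  proof -
    have "\<exists>a. F y = F (a (F 1))" for y
      by (rule exI[of _ "\<lambda>_. y"]) simp
    then show ?thesis
      by (subst Q.finite_span) (auto simp: carrier lincomb type_ring_def)
  qed
  moreover have "\<not> Q.lin_dep {F 1}"
  proof
    assume "Q.lin_dep {F 1}"
    then obtain A a v where *: "A \<subseteq> {F 1}" "v \<in> A" "Q.lincomb a A = \<zero>\<^bsub>Q\<^esub>" "a v \<noteq> \<zero>\<^bsub>type_ring\<^esub>"
      unfolding Q.lin_dep_def by blast
    then have "A = {F 1}" "v = F 1"
      by auto
    with * show False
      by (simp add: lincomb zero) (simp add: type_ring_def)
  qed
  ultimately have "Q.basis {F 1}"
    by (simp add: Q.basis_def carrier)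
  then have "Q.dim = 1"
    using Q.dim_basis[of "{F 1}"] by simp
  moreover have Q.fin_dim
    unfolding Q.fin_dim_def using span by (intro exI[of _ "{F 1}"]) (auto simp: carrier)
  moreover have "VectorSpace.subspace type_ring (F 0) poly_space"
    using vectorspace_poly_space
    by (intro subspace.intro submodule.intro vectorspace_poly_space)
      (auto simp: vectorspace_def F_def add smult, auto simp: F_def poly_space_def add smult)
  ultimately show ?thesis
    by (simp add: has_codim_def Q_def F_def)
qed

section \<open>The kernel of the retraction\<close>

abbreviation ker :: "('a poly ^ 2 ^ 2) set" where
  "ker \<equiv> kernel SL2 SL2 retraction"

lemma in_ker_iff: "A \<in> ker \<longleftrightarrow> det A = 1 \<and> retraction A = mat 1"
  by (simp add: kernel_def in_carrier_SL2_iff one_SL2)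

lemma normal_ker: "ker \<lhd> SL2"
  using group_hom.normal_kernel[OF group_hom_retraction] .

lemma retraction_mult: "det A = 1 \<Longrightarrow> det B = 1 \<Longrightarrow> retraction (A ** B) = retraction A ** retraction B"
  using multiplier_SL2 by (auto simp: multiplier_def)

lemma det_retraction: "det A = 1 \<Longrightarrow> det (retraction A) = 1"
  using multiplier_SL2 by (auto simp: multiplier_def)

text \<open>If \<open>C\<close> is \<open>retraction A\<close> read as a constant matrix, then
  \<open>A\<close> and \<open>C\<close> have the same retraction, and \<open>A\<close> is the
  product of an element of the kernel and \<open>C\<close>.\<close>

lemma ker_mult_const: "ker <#>\<^bsub>SL2\<^esub> SL2_const = carrier SL2"
proof -
  interpret group_hom SL2 SL2 retraction
    by (rule group_hom_retraction)
  have const: "map_matrix (\<lambda>c. [:c:]) A \<in> carrier SL2" if "A \<in> carrier SL2" for A :: "'a ^ 2 ^ 2"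
    using that by (simp add: in_carrier_SL2_iff det_2 one_pCons mult.commute)
  show ?thesis
  proof
    show "ker <#>\<^bsub>SL2\<^esub> SL2_const \<subseteq> carrier SL2"
      using const by (auto simp: set_mult_def SL2_const_def kernel_def)
    show "carrier SL2 \<subseteq> ker <#>\<^bsub>SL2\<^esub> SL2_const"
    proof
      fix A :: "'a poly ^ 2 ^ 2"
      assume A: "A \<in> carrier SL2"
      define C where "C = map_matrix (\<lambda>c. [:c:]) (retraction A)"
      have C: "C \<in> carrier SL2" "retraction C = retraction A" "C \<in> SL2_const"
        using const[of "retraction A"] A by (simp_all add: C_def retraction_const SL2_const_def)
      have "A \<otimes>\<^bsub>SL2\<^esub> inv\<^bsub>SL2\<^esub> C \<in> ker"
        using A C by (simp add: kernel_def)
      moreover have "A = (A \<otimes>\<^bsub>SL2\<^esub> inv\<^bsub>SL2\<^esub> C) \<otimes>\<^bsub>SL2\<^esub> C"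
        using A C by (simp add: G.m_assoc)
      ultimately show "A \<in> ker <#>\<^bsub>SL2\<^esub> SL2_const"
        using C unfolding set_mult_def by blast
    qed
  qed
qed

text \<open>By normality only membership of \<open>elem_T r\<close> in the kernel matters, and its
  retraction is \<open>elem_T (\<pi> r)\<close>.\<close>

lemma quasi_level_ker: "quasi_level ker = {r. \<pi> r = 0}"
proof -
  interpret normal ker SL2
    by (rule normal_ker)
  have T_N: "elem_T r \<in> ker \<longleftrightarrow> \<pi> r = 0" for r
    by (simp add: in_ker_iff retraction_elem_T) (simp add: elem_T_eq_mat2 mat_1_eq_mat2)
  show ?thesis
  proof (intro equalityI subsetI)
    fix r assume "r \<in> quasi_level ker"
    then obtain h where "h \<in> ker" "elem_T r = \<one>\<^bsub>SL2\<^esub> \<otimes>\<^bsub>SL2\<^esub> h \<otimes>\<^bsub>SL2\<^esub> inv\<^bsub>SL2\<^esub> \<one>\<^bsub>SL2\<^esub>"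
      unfolding quasi_level_def using one_closed by blast
    then show "r \<in> {r. \<pi> r = 0}"
      by (simp flip: T_N)
  next
    fix r assume "r \<in> {r. \<pi> r = 0}"
    then have r: "elem_T r \<in> ker"
      by (simp add: T_N)
    have "elem_T r \<in> (\<lambda>h. g \<otimes>\<^bsub>SL2\<^esub> h \<otimes>\<^bsub>SL2\<^esub> inv\<^bsub>SL2\<^esub> g) ` ker" if g: "g \<in> carrier SL2" for g
    proof
      have rc: "elem_T r \<in> carrier SL2"
        using r subset by blast
      show "inv\<^bsub>SL2\<^esub> g \<otimes>\<^bsub>SL2\<^esub> elem_T r \<otimes>\<^bsub>SL2\<^esub> g \<in> ker"
        using inv_op_closed1[OF g r] .
      have "g \<otimes>\<^bsub>SL2\<^esub> (inv\<^bsub>SL2\<^esub> g \<otimes>\<^bsub>SL2\<^esub> elem_T r \<otimes>\<^bsub>SL2\<^esub> g) = elem_T r \<otimes>\<^bsub>SL2\<^esub> g"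
        using g rc by (simp add: m_assoc[symmetric])
      then show "elem_T r = g \<otimes>\<^bsub>SL2\<^esub> (inv\<^bsub>SL2\<^esub> g \<otimes>\<^bsub>SL2\<^esub> elem_T r \<otimes>\<^bsub>SL2\<^esub> g) \<otimes>\<^bsub>SL2\<^esub> inv\<^bsub>SL2\<^esub> g"
        using g rc by (simp add: m_assoc)
    qed
    then show "r \<in> quasi_level ker"
      by (simp add: quasi_level_def)
  qed
qed

text \<open>An ideal inside the kernel of \<open>\<pi>\<close> contains all multiples of its
  elements \<open>p\<close>, so \<open>ann\<close> gives \<open>f dvd p\<close>.\<close>

lemma level_ker:
  assumes ann: "\<And>p. f dvd p \<longleftrightarrow> (\<forall>r. \<pi> (p * r) = 0)"
  shows "level ker = Idl\<^bsub>type_ring\<^esub> {f}"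
  unfolding level_def quasi_level_ker genideal_type_ring
proof (rule Greatest_equality)
  have "\<pi> p = 0" if "f dvd p" for p
    using that ann[of p] mult_1_right[of p] by metis
  then show "ideal {p. f dvd p} type_ring \<and> {p. f dvd p} \<subseteq> {r. \<pi> r = 0}"
    using ideal_multiples by auto
next
  fix I assume I: "ideal I type_ring \<and> I \<subseteq> {r. \<pi> r = 0}"
  have "p * r \<in> I" if "p \<in> I" for p r
    using I ideal.I_r_closed[of I type_ring p r] that by (simp add: type_ring_def)
  with I show "I \<le> {p. f dvd p}"
    by (auto simp: ann)
qed

text \<open>Modulo \<open>q\<close>, the matrix \<open>X\<close> conjugates \<open>elem_T r\<close>
  to \<open>elem_T (u\<^sup>2 * r)\<close>. The discrepancy lies in the kernel, so the retraction of
  \<open>X\<close> conjugates \<open>elem_T (\<pi> r)\<close> to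
  \<open>elem_T (\<pi> (u\<^sup>2 * r))\<close>.\<close>

lemma square_multiplier:
  assumes q: "ideal q type_ring" "SL2_cong q \<subseteq> ker" and uv: "1 - u * v \<in> q"
  shows "\<exists>a. \<forall>r. \<pi> (u\<^sup>2 * r) = a\<^sup>2 * \<pi> r"
proof -
  define e where "e = 1 - u * v"
  \<comment> \<open>a lift of the diagonal matrix with entries \<open>u\<close> and \<open>v\<close> modulo \<open>e\<close>\<close>
  define X where "X = mat2 (u * (1 + e)) (- e) e v"
  have uv_eq: "u * v = 1 - e"
    by (simp add: e_def)
  have "u * (1 + e) * v + e * e = (u * v) * (1 + e) + e * e"
    by (simp add: algebra_simps)
  then have det_X: "det X = 1"
    by (simp add: X_def uv_eq algebra_simps)
  obtain a b c d where M: "retraction X = mat2 a b c d"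
    using mat2_eta[of "retraction X"] by metis
  have ad: "a * d - b * c = 1"
    using det_retraction[OF det_X] by (simp add: M)
  have key: "retraction X ** elem_T (\<pi> r) = elem_T (\<pi> (u\<^sup>2 * r)) ** retraction X" for r
  proof -
    define A where "A = u * (1 + e)"
    \<comment> \<open>\<open>Z\<close> is the product of \<open>X\<close>, \<open>elem_T r\<close>, the inverse of \<open>X\<close> and \<open>elem_T (- (u\<^sup>2 * r))\<close>\<close>
    define Z where "Z = mat2 (1 - A * e * r) (A\<^sup>2 * r - u\<^sup>2 * r * (1 - A * e * r)) (- e\<^sup>2 * r)
      (1 + A * e * r + u\<^sup>2 * r * (e\<^sup>2 * r))"
    have Av: "A * v = 1 - e * e"
    proof -
      have "A * v = (1 + e) * (u * v)"
        by (simp add: A_def mult_ac)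
      then show ?thesis
        by (simp add: uv_eq algebra_simps)
    qed
    have "Z ** elem_T (u\<^sup>2 * r) = mat2 (1 - A * e * r) (A\<^sup>2 * r) (- e\<^sup>2 * r) (1 + A * e * r)"
      by (simp add: Z_def elem_T_eq_mat2 algebra_simps)
    \<comment> \<open>The relation \<open>Av\<close>, in the shapes that occur when the products
      below are expanded.\<close>
    moreover have "A * (A * (r * v)) = A * r - A * (e * (e * r))"
      "A * (e * (r * v)) = e * r - e * (e * (e * r))"
    proof -
      have "A * (x * (r * v)) = x * r * (A * v)" for x
        by (simp only: mult_ac)
      then show "A * (A * (r * v)) = A * r - A * (e * (e * r))"
        "A * (e * (r * v)) = e * r - e * (e * (e * r))"
        by (simp_all only: Av right_diff_distrib mult_1_right) (simp_all add: mult_ac)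
    qed
    ultimately have Z: "Z ** (elem_T (u\<^sup>2 * r) ** X) = X ** elem_T r"
      by (simp add: matrix_mul_assoc X_def flip: A_def)
        (simp add: elem_T_eq_mat2 algebra_simps power2_eq_square)
    have "p * e \<in> q" for p
      using ideal.I_l_closed[OF q(1), of e p] uv by (simp add: type_ring_def e_def)
    moreover have "\<forall>i j. e dvd Z $ i $ j - mat 1 $ i $ j"
    proof -
      have "A\<^sup>2 * r - u\<^sup>2 * r * (1 - A * e * r) = e * (u\<^sup>2 * r * (2 + e + A * r))"
        by (simp add: A_def power2_eq_square algebra_simps)
      then show ?thesis
        by (simp add: Z_def mat_1_eq_mat2 forall_2 power2_eq_square)
    qed
    ultimately have "\<forall>i j. Z $ i $ j - mat 1 $ i $ j \<in> q"
      by (metis dvdE mult.commute)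
    moreover have "det Z = 1"
      using arg_cong[OF Z, of det] det_X by (simp add: det_mul) (simp add: elem_T_eq_mat2)
    ultimately have "Z \<in> ker"
      using q(2) by (auto simp: SL2_cong_def in_carrier_SL2_iff)
    then have "retraction Z = mat 1"
      by (simp add: in_ker_iff)
    moreover have "det (elem_T s) = 1" for s :: "'a poly"
      by (simp add: elem_T_eq_mat2)
    ultimately show ?thesis
      using arg_cong[OF Z, of retraction] det_X \<open>det Z = 1\<close>
      by (simp add: retraction_mult det_mul retraction_elem_T)
  qed
  \<comment> \<open>For \<open>r = 1\<close> the lower right entries of the two sides are
    \<open>c + d\<close> and \<open>d\<close>.\<close>
  have "c = 0"
    using key[of 1] by (simp add: M elem_T_eq_mat2 one)
  then have "\<pi> (u\<^sup>2 * r) = a\<^sup>2 * \<pi> r" for r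
  proof -
    have "a * \<pi> r = \<pi> (u\<^sup>2 * r) * d"
      using key[of r] \<open>c = 0\<close> by (simp add: M elem_T_eq_mat2)
    then have "a * (a * \<pi> r) = \<pi> (u\<^sup>2 * r) * (a * d)"
      by (simp add: mult.left_commute)
    with ad \<open>c = 0\<close> show ?thesis
      by (simp add: power2_eq_square mult.assoc)
  qed
  then show ?thesis
    by blast
qed

lemma noncongruence_ker:
  assumes ann: "\<And>p. f dvd p \<longleftrightarrow> (\<forall>r. \<pi> (p * r) = 0)"
    and f0: "poly f 0 \<noteq> 0" and nsq: "\<And>a. \<not> f dvd [:0, 1:]\<^sup>2 - [:a:]"
  shows "noncongruence_subgroup ker"
proof -
  have "\<not> congruence_subgroup ker"
  proof
    assume "congruence_subgroup ker"
    then obtain q where q: "ideal q type_ring" "q \<noteq> {0}" "SL2_cong q \<subseteq> ker"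
      by (auto simp: congruence_subgroup_def)
    have q_mult: "p * r \<in> q" if "p \<in> q" for p r
      using ideal.I_r_closed[OF q(1) that, of r] by (simp add: type_ring_def)
    have "0 \<in> q"
      using additive_subgroup.zero_closed[OF ideal.axioms(1)[OF q(1)]] by (simp add: type_ring_def)
    with q(2) obtain g where g: "g \<in> q" "g \<noteq> 0"
      by blast
    obtain u v where u: "f dvd u - [:0, 1:]" and uv: "g dvd 1 - u * v"
      using obtain_invertible_mod_cong_X[OF f0 g(2)] .
    have "1 - u * v \<in> q"
      using uv g(1) q_mult by (auto elim!: dvdE)
    then obtain a where a: "\<pi> (u\<^sup>2 * r) = a\<^sup>2 * \<pi> r" for r
      using square_multiplier[OF q(1,3)] by blast
    \<comment> \<open>\<open>\<pi>\<close> vanishes on all multiples of this difference. As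
      \<open>u\<close> is congruent to \<open>t\<close> modulo \<open>f\<close>, \<open>u\<close>
      can then be replaced by \<open>t\<close>.\<close>
    have "f dvd u\<^sup>2 - [:a\<^sup>2:]"
      unfolding ann by (simp add: left_diff_distrib diff a smult)
    moreover have "f dvd (u - [:0, 1:]) * (u + [:0, 1:])"
      using u by simp
    then have "f dvd u\<^sup>2 - [:0, 1:]\<^sup>2"
      by (simp only: power2_eq_square square_diff_square_factored mult.commute)
    ultimately have "f dvd (u\<^sup>2 - [:a\<^sup>2:]) - (u\<^sup>2 - [:0, 1:]\<^sup>2)"
      by (rule dvd_diff)
    moreover have "(x - y) - (x - z) = z - y"
      for x y z :: "'a poly" by simp
    ultimately have "f dvd [:0, 1:]\<^sup>2 - [:a\<^sup>2:]"
      by metis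
    with nsq show False
      by blast
  qed
  then show ?thesis
    using normal_imp_subgroup[OF normal_ker] by (simp add: noncongruence_subgroup_def)
qed

end

section \<open>A functional with a prescribed largest ideal in its kernel\<close>

lemma functional_annihilator:
  fixes f :: "'a::field poly"
  assumes deg: "degree f > 0" and f0: "poly f 0 \<noteq> 0"
  obtains \<pi> where "normalized_functional \<pi>" "\<And>p. f dvd p \<longleftrightarrow> (\<forall>r. \<pi> (p * r) = 0)"
proof -
  \<comment> \<open>The largest possible degree of a remainder modulo \<open>f\<close>; the
    subtraction is exact since \<open>degree f > 0\<close>.\<close>
  define n where "n = degree f - 1"
  define s where "s = [:0, 1::'a:] ^ n"
  \<comment> \<open>The factor \<open>s\<close> ensures \<open>\<pi> 1 = 1\<close>, since
    \<open>s\<close> is its own remainder and is monic of degree \<open>n\<close>.\<close>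
  define \<pi> where "\<pi> p = coeff ((p * s) mod f) n" for p
  have f_nz: "f \<noteq> 0"
    using deg by auto
  have s_monom: "s = monom 1 n"
    by (simp add: s_def monom_altdef)
  then have s: "s mod f = s" "coeff s n = 1"
    using deg by (auto simp: n_def mod_poly_less degree_monom_eq)
  have "normalized_functional \<pi>"
    by standard (simp_all add: \<pi>_def s poly_mod_add_left distrib_right mod_smult_left)
  moreover have "f dvd p \<longleftrightarrow> (\<forall>r. \<pi> (p * r) = 0)" for p
  proof
    assume "f dvd p"
    then show "\<forall>r. \<pi> (p * r) = 0"
      by (auto simp: \<pi>_def elim!: dvdE simp flip: mult.assoc)
  next
    assume *: "\<forall>r. \<pi> (p * r) = 0"
    show "f dvd p"
    proof (rule ccontr)
      assume "\<not> f dvd p"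
      define p' where "p' = p mod f"
      have p': "p' \<noteq> 0" "degree p' \<le> n"
        using \<open>\<not> f dvd p\<close> degree_mod_less'[OF f_nz, of p] by (auto simp: p'_def n_def mod_eq_0_iff_dvd)
      \<comment> \<open>An inverse of \<open>s\<close> modulo \<open>f\<close> cancels the factor
        built into \<open>\<pi>\<close>.\<close>
      obtain k where "f dvd 1 - s * k"
      proof -
        have "\<exists>v. f dvd 1 - [:0, 1:] ^ i * v" for i
        proof (induction i)
          case 0
          show ?case
            by (rule exI[of _ 1]) simp
        next
          case (Suc i)
          then show ?case
            using X_invertible_mod[OF f0] invertible_mod_mult_left by (metis power_Suc)
        qed
        then show thesis
          using that by (auto simp: s_def)
      qed
      \<comment> \<open>This power of \<open>t\<close> raises the degree of \<open>p'\<close> to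
        exactly \<open>n\<close>, so no reduction occurs and \<open>\<pi>\<close> reads off the
        leading coefficient.\<close>
      define m where "m = [:0, 1::'a:] ^ (n - degree p')"
      have "(p * (k * m) * s) mod f = (p' * m) mod f"
      proof -
        have "f dvd (1 - s * k) * (p * m)"
          using \<open>f dvd 1 - s * k\<close> by simp
        then have "(p * m) mod f = (p * (k * m) * s) mod f"
          unfolding mod_eq_dvd_iff by (simp add: algebra_simps)
        then show ?thesis
          by (simp add: p'_def mod_mult_left_eq)
      qed
      also have deg_m: "degree (p' * m) = n"
        using p' by (simp add: m_def degree_mult_eq degree_linear_power)
      then have "(p' * m) mod f = p' * m"
        using deg by (intro mod_poly_less) (simp add: n_def)
      finally have "\<pi> (p * (k * m)) = lead_coeff (p' * m)"
        by (simp add: \<pi>_def deg_m)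
      moreover have "p' * m \<noteq> 0"
        using p' by (simp add: m_def)
      ultimately show False
        using * by (metis leading_coeff_0_iff)
    qed
  qed
  ultimately show thesis
    using that by blast
qed

theorem theorem4p12:
  fixes f :: "'a::field poly"
  assumes "degree f \<ge> 2"
    and "poly f 0 \<noteq> 0"
    and "degree f = 2 \<Longrightarrow> poly (pderiv f) 0 \<noteq> 0"
  shows "\<exists>N. N \<lhd> (SL2 :: ('a poly ^ 2 ^ 2) monoid) \<and> noncongruence_subgroup N \<and>
           N <#>\<^bsub>SL2\<^esub> SL2_const = carrier SL2 \<and>
           level N = Idl\<^bsub>type_ring\<^esub> {f} \<and>
           has_codim type_ring poly_space (quasi_level N) 1"
proof -
  have "degree f > 0"
    using assms(1) by simp
  then obtain \<pi> where "normalized_functional \<pi>" and ann: "\<And>p. f dvd p \<longleftrightarrow> (\<forall>r. \<pi> (p * r) = 0)"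
    using functional_annihilator[OF _ assms(2)] by blast
  then interpret normalized_functional \<pi>
    by simp
  \<comment> \<open>By degrees, such an \<open>f\<close> would be a nonzero constant multiple of
    \<open>t^2 - a\<close>, whose derivative vanishes at 0.\<close>
  have "\<not> f dvd [:0, 1:]\<^sup>2 - [:a:]" for a
  proof
    assume "f dvd [:0, 1:]\<^sup>2 - [:a:]"
    moreover have eq: "[:0, 1:]\<^sup>2 - [:a:] = [:- a, 0, 1:]"
      by (simp add: power2_eq_square)
    ultimately obtain h where h: "[:- a, 0, 1:] = f * h"
      by (auto elim: dvdE)
    then have nz: "f \<noteq> 0" "h \<noteq> 0"
      by auto
    then have "degree f + degree h = 2"
      using arg_cong[OF h, of degree] by (simp add: degree_mult_eq)
    with assms(1) have deg: "degree f = 2" "degree h = 0"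
      by auto
    then obtain c where "h = [:c:]"
      by (elim degree_eq_zeroE)
    with h nz have "pderiv [:- a, 0, 1:] = Polynomial.smult c (pderiv f)" "c \<noteq> 0"
      by (simp_all add: pderiv_smult)
    then have "c * poly (pderiv f) 0 = poly (pderiv [:- a, 0, 1:]) 0"
      by simp
    also have "\<dots> = 0"
      by (simp add: pderiv_pCons)
    finally have "c * poly (pderiv f) 0 = 0" .
    with assms(3)[OF deg(1)] \<open>c \<noteq> 0\<close> show False
      by simp
  qed
  then have "noncongruence_subgroup ker"
    by (intro noncongruence_ker[OF ann assms(2)])
  then show ?thesis
    using normal_ker ker_mult_const level_ker[OF ann] has_codim_kernel
    by (intro exI[of _ ker]) (simp add: quasi_level_ker)
qed

end
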